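(* Let $X$ be a uniformly smooth Banach space and let $A$ be a uniform algebra. Then the pair $(X,A)$ has the Bishop-Phelps-Bollobás point property.
   Context: All spaces are over the same scalar field $\mathbb{K}$, which is $\mathbb{R}$ or $\mathbb{C}$. $S_X$ and $B_X$ are the unit sphere and closed unit ball of $X$, and $\mathcal{L}(X,Y)$ is the space of bounded linear operators from $X$ into $Y$. A Banach space $X$ is uniformly smooth if the limit $\lim_{t\to 0}\frac{\|z+tx\|-1}{t}$ exists uniformly for all $x\in B_X$ and $z\in S_X$. For a compact Hausdorff space $K$, $C(K)$ is the space of continuous scalar-valued functions on $K$ with the supremum norm $\|\cdot\|_\infty$; a uniform algebra is a $\|\cdot\|_\infty$-closed subalgebra $A\subset C(K)$ (for some compact Hausdorff space $K$), endowed with the supremum norm, that separates the points of $K$. A pair $(X,Y)$ of Banach spaces has the Bishop-Phelps-Bollobás point property (BPBpp) if for every $\varepsilon>0$ there exists $\eta(\varepsilon)>0$ such that whenever $T\in\mathcal{L}(X,Y)$ with $\|T\|=1$ and $x\in S_X$ satisfy $\|T(x)\|>1-\eta(\varepsilon)$, there exists $S\in\mathcal{L}(X,Y)$ with $\|S\|=1$ such that $\|S(x)\|=1$ and $\|S-T\|<\varepsilon$. *)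

theory Defs
  imports "HOL-Analysis.Analysis"
begin

text \<open>
  A normed space over a scalar field \<open>'k\<close> (below: the reals or the complex numbers) is given by its
  underlying real normed space, a type \<open>'x\<close>, together with a \<open>'k\<close>-scalar multiplication extending
  the real one. For \<open>'k = real\<close> the last assumption forces \<open>scale = (*\<^sub>R)\<close>.
\<close>

locale normed_space_over = vector_space scale
  for scale :: "'k::real_normed_field \<Rightarrow> 'x::real_normed_vector \<Rightarrow> 'x" +
  assumes norm_scale: "norm (scale c x) = norm c * norm x"
    and scale_of_real: "scale (of_real r) x = r *\<^sub>R x"

lemma normed_space_over_scaleR:
  "normed_space_over ((*\<^sub>R) :: real \<Rightarrow> 'x::real_normed_vector \<Rightarrow> 'x)"
  by unfold_locales (simp_all add: algebra_simps)

text \<open>The parameter \<open>t\<close> is real and tends to \<open>0\<close> from both sides, also for complex spaces.\<close>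

definition uniformly_smooth :: "'x::real_normed_vector itself \<Rightarrow> bool" where
  "uniformly_smooth _ \<longleftrightarrow>
    (\<exists>l. uniform_limit (sphere (0::'x) 1 \<times> cball (0::'x) 1)
           (\<lambda>(t::real) (z, x). (norm (z + t *\<^sub>R x) - 1) / t) l (at 0))"

definition bcontfun_scale ::
    "'k::real_normed_field \<Rightarrow> ('c::topological_space \<Rightarrow>\<^sub>C 'k) \<Rightarrow> 'c \<Rightarrow>\<^sub>C 'k" where
  "bcontfun_scale c f = Bcontfun (\<lambda>s. c * apply_bcontfun f s)"

definition bcontfun_mult ::
    "('c::topological_space \<Rightarrow>\<^sub>C 'k::real_normed_field) \<Rightarrow> ('c \<Rightarrow>\<^sub>C 'k) \<Rightarrow> 'c \<Rightarrow>\<^sub>C 'k" where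
  "bcontfun_mult f g = Bcontfun (\<lambda>s. apply_bcontfun f s * apply_bcontfun g s)"

lemma apply_bcontfun_mult [simp]:
  "apply_bcontfun (bcontfun_mult f g) s = apply_bcontfun f s * apply_bcontfun g s"
proof -
  have "norm (apply_bcontfun f s * apply_bcontfun g s) \<le> norm f * norm g" for s
    by (simp add: norm_mult mult_mono' norm_bounded)
  then have "(\<lambda>s. apply_bcontfun f s * apply_bcontfun g s) \<in> bcontfun"
    by (auto simp: bcontfun_def bounded_iff intro!: continuous_on_mult)
  then show ?thesis
    by (simp add: bcontfun_mult_def Bcontfun_inverse)
qed

lemma apply_bcontfun_scale [simp]:
  "apply_bcontfun (bcontfun_scale c f) s = c * apply_bcontfun f s"
proof -
  have "bcontfun_scale c f = bcontfun_mult (const_bcontfun c) f"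
    by (simp add: bcontfun_scale_def bcontfun_mult_def const_bcontfun.rep_eq)
  then show ?thesis
    by (simp add: const_bcontfun.rep_eq)
qed

text \<open>
  For compact \<open>'c\<close>, the type \<open>'c \<Rightarrow>\<^sub>C 'k\<close> is the space of all continuous \<open>'k\<close>-valued functions with
  the supremum norm. The algebra is not required to contain the constants.
\<close>

definition uniform_algebra :: "('c::t2_space \<Rightarrow>\<^sub>C 'k::real_normed_field) set \<Rightarrow> bool" where
  "uniform_algebra A \<longleftrightarrow>
     compact (UNIV :: 'c set) \<and> closed A \<and>
     module.subspace bcontfun_scale A \<and>
     (\<forall>f\<in>A. \<forall>g\<in>A. bcontfun_mult f g \<in> A) \<and>
     (\<forall>s t. s \<noteq> t \<longrightarrow> (\<exists>f\<in>A. apply_bcontfun f s \<noteq> apply_bcontfun f t))"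

text \<open>
  Bounded \<open>'k\<close>-linear operators into a subspace \<open>Y\<close> of the normed space \<open>'y\<close>; their norm is the
  operator norm of the type of bounded real-linear maps.
\<close>

definition operators_into ::
    "('k::real_normed_field \<Rightarrow> 'x \<Rightarrow> 'x) \<Rightarrow> ('k \<Rightarrow> 'y \<Rightarrow> 'y) \<Rightarrow> 'y set
      \<Rightarrow> ('x::real_normed_vector \<Rightarrow>\<^sub>L 'y::real_normed_vector) set" where
  "operators_into scaleX scaleY Y =
     {T. Vector_Spaces.linear scaleX scaleY (blinfun_apply T) \<and> range (blinfun_apply T) \<subseteq> Y}"

definition BPBpp ::
    "('k::real_normed_field \<Rightarrow> 'x \<Rightarrow> 'x::real_normed_vector)
      \<Rightarrow> ('k \<Rightarrow> 'y \<Rightarrow> 'y::real_normed_vector) \<Rightarrow> 'y set \<Rightarrow> bool" where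
  "BPBpp scaleX scaleY Y \<longleftrightarrow>
     (\<forall>\<epsilon>>0. \<exists>\<eta>>0. \<forall>T \<in> operators_into scaleX scaleY Y. \<forall>x \<in> sphere 0 1.
        norm T = 1 \<and> norm (blinfun_apply T x) > 1 - \<eta> \<longrightarrow>
        (\<exists>S \<in> operators_into scaleX scaleY Y.
           norm S = 1 \<and> norm (blinfun_apply S x) = 1 \<and> norm (S - T) < \<epsilon>))"

lemma normed_space_over_bcontfun_scale:
  "normed_space_over
     (bcontfun_scale :: 'k::real_normed_field \<Rightarrow> ('c::topological_space \<Rightarrow>\<^sub>C 'k) \<Rightarrow> _)"
proof unfold_locales
  fix c :: 'k and f :: "'c \<Rightarrow>\<^sub>C 'k"
  have le: "norm (bcontfun_scale d g) \<le> norm d * norm g" for d :: 'k and g :: "'c \<Rightarrow>\<^sub>C 'k"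
    by (rule norm_bound)
      (simp add: norm_mult mult_left_mono norm_bounded)
  show "norm (bcontfun_scale c f) = norm c * norm f"
  proof (cases "c = 0")
    case True
    then show ?thesis using le[of c f] by simp
  next
    case False
    have "bcontfun_scale (inverse c) (bcontfun_scale c f) = f"
      by (rule bcontfun_eqI) (simp add: False)
    then have "norm f \<le> norm (inverse c) * norm (bcontfun_scale c f)"
      using le[of "inverse c" "bcontfun_scale c f"] by simp
    then have "norm c * norm f \<le> norm (bcontfun_scale c f)"
      using False unfolding norm_inverse by (simp add: field_simps)
    then show ?thesis using le[of c f] by simp
  qed
qed (auto intro!: bcontfun_eqI
    simp: plus_bcontfun.rep_eq scaleR_bcontfun.rep_eq algebra_simps
      scaleR_conv_of_real)

end

theory Submission
  imports Defs
begin

text \<open>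
  Two facts carry the proof.

  Uniform smoothness says, by Smulyan's criterion, that any two functionals in the dual ball that
  almost norm the same unit vector \<open>x\<close> are close to each other, and close to the functional \<open>j\<close> that
  attains its norm at \<open>x\<close>, namely the derivative of the norm (\<open>uniform_smulyan_real\<close>, with its
  complexification \<open>uniform_smulyan_complex\<close>).

  If \<open>norm (T x)\<close> is almost one, the function \<open>T x\<close> itself is an element of the algebra that, up to a
  scalar, peaks at a point \<open>s\<^sub>0\<close>. Convergent power series in \<open>T x\<close> without constant term turn it
  into an element \<open>f\<close> with \<open>f s\<^sub>0 = 1\<close>, with \<open>f\<close> small where
  \<open>T x\<close> is away from its value at \<open>s\<^sub>0\<close>, and with values in the Stolz region
  \<open>norm w + (1 - e) * norm (1 - w) \<le> 1\<close> (\<open>has_stolz_peaks_real\<close>, \<open>has_stolz_peaks_complex\<close>). In the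
  complex case the passage to the Stolz region uses the binomial series of \<open>1 - (1 - z) powr \<alpha>\<close> for
  small \<open>\<alpha>\<close>, whose coefficients are nonnegative and sum to one.

  The operator \<open>S = f \<cdot> (c\<^sup>-\<^sup>1 j) + (1 - e) (1 - f) \<cdot> T\<close> with a unimodular constant \<open>c\<close> then has norm at
  most one by the Stolz condition, satisfies \<open>norm (S x) = 1\<close> because of its value at \<open>s\<^sub>0\<close>, and is
  close to \<open>T\<close>: where \<open>f\<close> is not small, \<open>T x\<close> is close to its value at \<open>s\<^sub>0\<close>, and there Smulyan's
  criterion applies to the functional \<open>h \<mapsto> c T h s\<close>.
\<close>

section \<open>The derivative of the norm\<close>

lemma norm_derivative_scaled_quotient:
  fixes z h :: "'x::real_normed_vector"
  assumes lim: "((\<lambda>t. (norm (z + t *\<^sub>R h) - 1) / t) \<longlongrightarrow> l) (at 0)" and z: "norm z = 1"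
  shows "((\<lambda>t. (norm (z + t *\<^sub>R (c *\<^sub>R h)) - 1) / t) \<longlongrightarrow> c * l) (at 0)"
proof (cases "c = 0")
  case True
  then show ?thesis by (simp add: z)
next
  case False
  have "filterlim (\<lambda>t. t * c) (at 0) (at 0)"
    using False by (auto simp: filterlim_at eventually_at_filter intro!: tendsto_eq_intros)
  from filterlim_compose[OF lim this]
  have "((\<lambda>t. c * ((norm (z + (t * c) *\<^sub>R h) - 1) / (t * c))) \<longlongrightarrow> c * l) (at 0)"
    by (intro tendsto_intros)
  then show ?thesis using False by simp
qed

text \<open>
  The difference quotients of the norm are sublinear in the direction up to a rescaling of \<open>t\<close>.
  So a one-sided derivative is sublinear, and a two-sided one is odd as well, hence additive.
\<close>

lemma norm_derivative_linear:
  fixes D :: "'x::real_normed_vector \<Rightarrow> real"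
  assumes D: "\<And>h. ((\<lambda>t. (norm (z + t *\<^sub>R h) - 1) / t) \<longlongrightarrow> D h) (at 0)" and z: "norm z = 1"
  shows "linear D" "\<And>h. \<bar>D h\<bar> \<le> norm h" "D z = 1"
proof -
  have Dr: "((\<lambda>t. (norm (z + t *\<^sub>R h) - 1) / t) \<longlongrightarrow> D h) (at_right 0)" for h
    using D by (rule filterlim_mono) (auto simp: at_le)
  have pos: "eventually (\<lambda>t. t > 0) (at_right (0::real))"
    by (simp add: eventually_at_right_less)
  have scale: "D (c *\<^sub>R h) = c * D h" for c h
    using LIM_unique[OF D norm_derivative_scaled_quotient[OF D z]] by simp
  have minus: "D (- h) = - D h" for h
    using scale[of "-1" h] by simp
  have sub: "D (h + k) \<le> D h + D k" for h k
  proof -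
    \<comment> \<open>Convexity of the norm at the midpoint of \<open>z + 2th\<close> and \<open>z + 2tk\<close>.\<close>
    have "D (h + k) \<le> (D (2 *\<^sub>R h) + D (2 *\<^sub>R k)) / 2"
    proof (rule tendsto_le[OF _ _ Dr])
      show "((\<lambda>t. ((norm (z + t *\<^sub>R (2 *\<^sub>R h)) - 1) / t + (norm (z + t *\<^sub>R (2 *\<^sub>R k)) - 1) / t) / 2)
          \<longlongrightarrow> (D (2 *\<^sub>R h) + D (2 *\<^sub>R k)) / 2) (at_right 0)"
        by (intro tendsto_intros Dr) simp
      show "\<forall>\<^sub>F t in at_right 0. (norm (z + t *\<^sub>R (h + k)) - 1) / t
          \<le> ((norm (z + t *\<^sub>R (2 *\<^sub>R h)) - 1) / t + (norm (z + t *\<^sub>R (2 *\<^sub>R k)) - 1) / t) / 2"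
        using pos
      proof eventually_elim
        case (elim t)
        have "2 *\<^sub>R (z + t *\<^sub>R (h + k)) = (z + t *\<^sub>R (2 *\<^sub>R h)) + (z + t *\<^sub>R (2 *\<^sub>R k))"
          by (simp add: scaleR_right_distrib scaleR_2[of z] mult.commute)
        then have "2 * norm (z + t *\<^sub>R (h + k)) \<le>
            norm (z + t *\<^sub>R (2 *\<^sub>R h)) + norm (z + t *\<^sub>R (2 *\<^sub>R k))"
          by (metis norm_scaleR norm_triangle_ineq abs_numeral)
        then show ?case
          using elim by (simp add: divide_simps) 
      qed
    qed simp
    then show ?thesis by (simp add: scale)
  qed
  have add: "D (h + k) = D h + D k" for h k
    using sub[of h k] sub[of "- h" "- k"] minus[of "h + k"] by (simp add: minus)
  show "linear D"
    by (rule linearI) (simp_all add: add scale)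
  have le: "D h \<le> norm h" for h
  proof (rule tendsto_upperbound[OF Dr])
    show "\<forall>\<^sub>F t in at_right 0. (norm (z + t *\<^sub>R h) - 1) / t \<le> norm h"
      using pos
    proof eventually_elim
      case (elim t)
      then show ?case
        using norm_triangle_ineq[of z "t *\<^sub>R h"] z by (simp add: divide_simps mult.commute)
    qed
  qed simp
  show "\<bar>D h\<bar> \<le> norm h" for h
    using le[of h] le[of "- h"] by (simp add: minus)
  show "D z = 1"
  proof (rule tendsto_unique[OF _ Dr])
    show "((\<lambda>t. (norm (z + t *\<^sub>R z) - 1) / t) \<longlongrightarrow> 1) (at_right 0)"
    proof (rule tendsto_eventually)
      show "\<forall>\<^sub>F t in at_right 0. (norm (z + t *\<^sub>R z) - 1) / t = 1"
        using pos
      proof eventually_elim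
        case (elim t)
        have "z + t *\<^sub>R z = (1 + t) *\<^sub>R z" by (simp add: algebra_simps)
        then show ?case using elim z by simp
      qed
    qed
  qed simp
qed

text \<open>
  Uniform smoothness in the form in which it is used: a single step length \<open>t\<close>, the same for all
  points \<open>z\<close> and directions \<open>h\<close>, at which the linearisation of the norm is accurate up to \<open>t e\<close>.
\<close>

lemma uniformly_smooth_norm_derivative:
  assumes "uniformly_smooth TYPE('x::real_normed_vector)"
  obtains D :: "'x::real_normed_vector \<Rightarrow> 'x \<Rightarrow> real"
  where "\<And>z. norm z = 1 \<Longrightarrow> linear (D z)"
    and "\<And>z h. norm z = 1 \<Longrightarrow> \<bar>D z h\<bar> \<le> norm h"
    and "\<And>z. norm z = 1 \<Longrightarrow> D z z = 1"
    and "\<And>e. e > 0 \<Longrightarrow> \<exists>t>0. \<forall>z h. norm z = 1 \<and> norm h \<le> 1 \<longrightarrow>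
           norm (z + t *\<^sub>R h) \<le> 1 + t * (D z h + e)"
proof -
  from assms obtain l where l: "uniform_limit (sphere (0::'x) 1 \<times> cball (0::'x) 1)
           (\<lambda>(t::real) (z, x). (norm (z + t *\<^sub>R x) - 1) / t) l (at 0)"
    unfolding uniformly_smooth_def by blast
  have lim1: "((\<lambda>t. (norm (z + t *\<^sub>R h) - 1) / t) \<longlongrightarrow> l (z, h)) (at 0)"
    if "norm z = 1" "norm h \<le> 1" for z h
    using tendsto_uniform_limitI[OF l, of "(z, h)"] that by simp
  \<comment> \<open>The limit \<open>l\<close> is only known for directions in the unit ball; extend it homogeneously.\<close>
  define D where "D z h = norm h * l (z, sgn h)" for z h :: 'x
  have D: "((\<lambda>t. (norm (z + t *\<^sub>R h) - 1) / t) \<longlongrightarrow> D z h) (at 0)" if "norm z = 1" for z h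
    using norm_derivative_scaled_quotient[OF lim1[OF that, of "sgn h"] that, of "norm h"]
    by (cases "h = 0") (simp_all add: D_def norm_sgn sgn_div_norm)
  have unif: "\<exists>t>0. \<forall>z h. norm z = 1 \<and> norm h \<le> 1 \<longrightarrow>
           norm (z + t *\<^sub>R h) \<le> 1 + t * (D z h + e)" if e: "e > 0" for e
  proof -
    obtain d where "d > 0" and unif_d: "\<And>t. t \<noteq> 0 \<Longrightarrow> \<bar>t\<bar> < d \<Longrightarrow>
        \<forall>p \<in> sphere (0::'x) 1 \<times> cball 0 1.
          dist (case p of (z, x) \<Rightarrow> (norm (z + t *\<^sub>R x) - 1) / t) (l p) < e"
      using uniform_limitD[OF l e] unfolding eventually_at by (auto simp: dist_real_def)
    have d: "d > 0" "\<And>t z h. t \<noteq> 0 \<Longrightarrow> \<bar>t\<bar> < d \<Longrightarrow> norm z = 1 \<Longrightarrow> norm h \<le> 1 \<Longrightarrow>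
         \<bar>(norm (z + t *\<^sub>R h) - 1) / t - l (z, h)\<bar> < e"
      subgoal by fact
      subgoal for t z h using bspec[OF unif_d, of t "(z, h)"] by (simp add: dist_real_def)
      done
    have "norm (z + (d/2) *\<^sub>R h) \<le> 1 + (d/2) * (D z h + e)" if "norm z = 1" "norm h \<le> 1" for z h
    proof -
      have "l (z, h) = D z h"
        using LIM_unique[OF lim1[OF that] D[OF that(1)]] .
      then have "(norm (z + (d/2) *\<^sub>R h) - 1) / (d/2) < D z h + e"
        using d(2)[of "d/2" z h] that d(1) by simp
      then have "norm (z + (d/2) *\<^sub>R h) - 1 < (D z h + e) * (d/2)"
        using d(1) by (subst (asm) pos_divide_less_eq) auto
      then show ?thesis by (simp add: mult.commute)
    qed
    then show ?thesis using d(1) by (intro exI[of _ "d/2"]) simp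
  qed
  show thesis
    using norm_derivative_linear[OF D] unif by (intro that[of D]) blast+
qed

text \<open>
  The easy half of Smulyan's criterion, with uniform constants. A functional \<open>\<phi>\<close> in the dual ball
  lies below the norm, and it almost touches it at \<open>z\<close>; evaluating at \<open>z + t h\<close> shows
  \<open>t \<phi> h \<le> t D z h\<close> up to the loss \<open>1 - \<phi> z\<close> at \<open>z\<close> and the error of the linearisation.
  Replacing \<open>h\<close> by \<open>- h\<close> gives the reverse estimate.
\<close>

lemma uniform_smulyan_real:
  assumes "uniformly_smooth TYPE('x::real_normed_vector)"
  obtains D :: "'x::real_normed_vector \<Rightarrow> 'x \<Rightarrow> real"
  where "\<And>z. norm z = 1 \<Longrightarrow> linear (D z)"
    and "\<And>z h. norm z = 1 \<Longrightarrow> \<bar>D z h\<bar> \<le> norm h"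
    and "\<And>z. norm z = 1 \<Longrightarrow> D z z = 1"
    and "\<And>e. e > 0 \<Longrightarrow> \<exists>d>0. \<forall>z \<phi>. norm z = 1 \<and> linear \<phi> \<and> (\<forall>h. \<phi> h \<le> norm h) \<and> 1 - d < \<phi> z
           \<longrightarrow> (\<forall>h. \<bar>\<phi> h - D z h\<bar> \<le> e * norm h)"
proof -
  obtain D :: "'x \<Rightarrow> 'x \<Rightarrow> real"
  where lin: "\<And>z. norm z = 1 \<Longrightarrow> linear (D z)"
    and le: "\<And>z h. norm z = 1 \<Longrightarrow> \<bar>D z h\<bar> \<le> norm h"
    and one: "\<And>z. norm z = 1 \<Longrightarrow> D z z = 1"
    and unif: "\<And>e. e > 0 \<Longrightarrow> \<exists>t>0. \<forall>z h. norm z = 1 \<and> norm h \<le> 1 \<longrightarrow>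
           norm (z + t *\<^sub>R h) \<le> 1 + t * (D z h + e)"
    using uniformly_smooth_norm_derivative[OF assms] by blast
  have "\<exists>d>0. \<forall>z \<phi>. norm z = 1 \<and> linear \<phi> \<and> (\<forall>h. \<phi> h \<le> norm h) \<and> 1 - d < \<phi> z
           \<longrightarrow> (\<forall>h. \<bar>\<phi> h - D z h\<bar> \<le> e * norm h)" if e: "e > 0" for e
  proof -
    obtain t where t: "t > 0" "\<And>z h. norm z = 1 \<Longrightarrow> norm h \<le> 1 \<Longrightarrow>
           norm (z + t *\<^sub>R h) \<le> 1 + t * (D z h + e / 2)"
      using unif[of "e / 2"] e by auto
    have "\<bar>\<phi> h - D z h\<bar> \<le> e * norm h"
      if z: "norm z = 1" and \<phi>: "linear \<phi>" "\<And>h. \<phi> h \<le> norm h" "1 - t * e / 2 < \<phi> z" for z \<phi> h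
    proof -
      have half: "\<phi> k - D z k \<le> e" if "norm k \<le> 1" for k
      proof -
        have "\<phi> z + t * \<phi> k \<le> norm (z + t *\<^sub>R k)"
          using \<phi>(2)[of "z + t *\<^sub>R k"] by (simp add: linear_add[OF \<phi>(1)] linear_scale[OF \<phi>(1)])
        then have "t * (\<phi> k - D z k) \<le> t * e"
          using t(2)[OF z that] \<phi>(3) by (simp add: algebra_simps)
        then show ?thesis using t(1) by simp
      qed
      have bound: "\<bar>\<phi> k - D z k\<bar> \<le> e" if "norm k \<le> 1" for k
        using half[of k] half[of "- k"] that
        by (simp add: linear_neg[OF \<phi>(1)] linear_neg[OF lin[OF z]] abs_le_iff)
      have "\<phi> h - D z h = norm h * (\<phi> (sgn h) - D z (sgn h))"
        by (cases "h = 0")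
          (simp_all add: sgn_div_norm linear_scale[OF \<phi>(1)] linear_scale[OF lin[OF z]]
             linear_0[OF \<phi>(1)] linear_0[OF lin[OF z]] field_simps)
      then show ?thesis
        using mult_left_mono[OF bound[of "sgn h"] norm_ge_zero[of h]]
        by (simp add: abs_mult norm_sgn mult.commute)
    qed
    then show ?thesis using t(1) e by (intro exI[of _ "t * e / 2"]) auto
  qed
  with lin le one show thesis by (intro that[of D]) blast+
qed

text \<open>
  A common form of the criterion for both scalar fields. A general normed field has
  no real parts, hence the condition \<open>norm (\<phi> x - 1) < d\<close>.
\<close>

definition uniform_smulyan :: "('k::real_normed_field \<Rightarrow> 'x::real_normed_vector \<Rightarrow> 'x) \<Rightarrow> bool" where
  "uniform_smulyan scaleX \<longleftrightarrow> (\<forall>e>0. \<exists>d>0. \<forall>x \<in> sphere 0 1. \<exists>j.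
     Vector_Spaces.linear scaleX (*) j \<and> (\<forall>h. norm (j h) \<le> norm h) \<and> j x = 1 \<and>
     (\<forall>\<phi>. Vector_Spaces.linear scaleX (*) \<phi> \<and> (\<forall>h. norm (\<phi> h) \<le> norm h) \<and> norm (\<phi> x - 1) < d \<longrightarrow>
        (\<forall>h. norm (\<phi> h - j h) \<le> e * norm h)))"

lemma uniform_smulyan_scaleR:
  assumes "uniformly_smooth TYPE('x::real_normed_vector)"
  shows "uniform_smulyan ((*\<^sub>R) :: real \<Rightarrow> 'x \<Rightarrow> 'x)"
proof -
  obtain D :: "'x \<Rightarrow> 'x \<Rightarrow> real"
  where lin: "\<And>z. norm z = 1 \<Longrightarrow> linear (D z)"
    and le: "\<And>z h. norm z = 1 \<Longrightarrow> \<bar>D z h\<bar> \<le> norm h"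
    and one: "\<And>z. norm z = 1 \<Longrightarrow> D z z = 1"
    and smul: "\<And>e. e > 0 \<Longrightarrow> \<exists>d>0. \<forall>z \<phi>. norm z = 1 \<and> linear \<phi> \<and> (\<forall>h. \<phi> h \<le> norm h) \<and> 1 - d < \<phi> z
           \<longrightarrow> (\<forall>h. \<bar>\<phi> h - D z h\<bar> \<le> e * norm h)"
    using uniform_smulyan_real[OF assms] by blast
  have lin': "Vector_Spaces.linear (*\<^sub>R) (*) \<phi> \<longleftrightarrow> linear \<phi>" for \<phi> :: "'x \<Rightarrow> real"
    by (simp add: linear_def real_scaleR_def[abs_def])
  show ?thesis
    unfolding uniform_smulyan_def lin'
  proof (intro allI impI)
    fix e :: real assume "e > 0"
    then obtain d where d: "d > 0" "\<And>z \<phi> h. norm z = 1 \<Longrightarrow> linear \<phi> \<Longrightarrow> (\<And>h. \<phi> h \<le> norm h) \<Longrightarrow>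
        1 - d < \<phi> z \<Longrightarrow> \<bar>\<phi> h - D z h\<bar> \<le> e * norm h"
      using smul by meson
    have near: "\<bar>\<phi> h - D x h\<bar> \<le> e * norm h"
      if "norm x = 1" "linear \<phi>" "\<And>h. \<bar>\<phi> h\<bar> \<le> norm h" "\<bar>\<phi> x - 1\<bar> < d" for x \<phi> h
    proof (rule d(2)[OF that(1,2)])
      show "\<phi> k \<le> norm k" for k using that(3)[of k] by simp
    qed (use that(4) in simp)
    then show "\<exists>d>0. \<forall>x\<in>sphere (0::'x) 1. \<exists>j :: 'x \<Rightarrow> real. linear j \<and> (\<forall>h. norm (j h) \<le> norm h) \<and> j x = 1 \<and>
        (\<forall>\<phi>. linear \<phi> \<and> (\<forall>h. norm (\<phi> h) \<le> norm h) \<and> norm (\<phi> x - 1) < d \<longrightarrow>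
          (\<forall>h. norm (\<phi> h - j h) \<le> e * norm h))"
    proof (intro exI[of _ d] conjI ballI)
      fix x :: 'x assume "x \<in> sphere 0 1"
      then have x: "norm x = 1" by simp
      then show "\<exists>j :: 'x \<Rightarrow> real. linear j \<and> (\<forall>h. norm (j h) \<le> norm h) \<and> j x = 1 \<and>
          (\<forall>\<phi>. linear \<phi> \<and> (\<forall>h. norm (\<phi> h) \<le> norm h) \<and> norm (\<phi> x - 1) < d \<longrightarrow>
            (\<forall>h. norm (\<phi> h - j h) \<le> e * norm h))"
        using lin[OF x] le[OF x] one[OF x] near[OF x] by (intro exI[of _ "D x"]) auto
    qed (rule d(1))
  qed
qed

text \<open>
  A complex-linear form is as large as its real part: rotate the argument so that the value becomes
  real.
\<close>

lemma complex_norm_le_by_rotation: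
  assumes X: "normed_space_over (scaleC :: complex \<Rightarrow> 'x::real_normed_vector \<Rightarrow> 'x)"
    and hom: "\<And>c h. f (scaleC c h) = c * f h"
    and Re: "\<And>h. Re (f h) \<le> r * norm h"
  shows "norm (f h) \<le> r * norm h"
proof (cases "f h = 0")
  case True
  then show ?thesis using Re[of h] by simp
next
  case False
  interpret normed_space_over scaleC by (rule X)
  define c where "c = of_real (norm (f h)) / f h"
  have c: "norm c = 1" "c * f h = of_real (norm (f h))"
    using False by (simp_all add: c_def norm_divide)
  show ?thesis
    using Re[of "scaleC c h"] by (simp add: hom c norm_scale)
qed

lemma uniform_smulyan_complex:
  assumes smooth: "uniformly_smooth TYPE('x::real_normed_vector)"
    and X: "normed_space_over (scaleC :: complex \<Rightarrow> 'x \<Rightarrow> 'x)"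
  shows "uniform_smulyan scaleC"
proof -
  interpret normed_space_over scaleC by (rule X)
  obtain D :: "'x \<Rightarrow> 'x \<Rightarrow> real"
  where lin: "\<And>z. norm z = 1 \<Longrightarrow> linear (D z)"
    and le: "\<And>z h. norm z = 1 \<Longrightarrow> \<bar>D z h\<bar> \<le> norm h"
    and one: "\<And>z. norm z = 1 \<Longrightarrow> D z z = 1"
    and smul: "\<And>e. e > 0 \<Longrightarrow> \<exists>d>0. \<forall>z \<phi>. norm z = 1 \<and> linear \<phi> \<and> (\<forall>h. \<phi> h \<le> norm h) \<and> 1 - d < \<phi> z
           \<longrightarrow> (\<forall>h. \<bar>\<phi> h - D z h\<bar> \<le> e * norm h)"
    using uniform_smulyan_real[OF smooth] by blast
  have vs: "vector_space ((*) :: complex \<Rightarrow> complex \<Rightarrow> complex)"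
    by unfold_locales (simp_all add: algebra_simps)
  have linC: "Vector_Spaces.linear scaleC (*) \<phi> \<longleftrightarrow>
      (\<forall>h k. \<phi> (h + k) = \<phi> h + \<phi> k) \<and> (\<forall>c h. \<phi> (scaleC c h) = c * \<phi> h)" for \<phi> :: "'x \<Rightarrow> complex"
    by (simp add: Vector_Spaces.linear_iff vs vector_space_axioms)
  \<comment> \<open>The unique complex-linear form with real part \<open>D z\<close>.\<close>
  define j where "j z h = Complex (D z h) (- D z (scaleC \<i> h))" for z h
  have j_lin: "Vector_Spaces.linear scaleC (*) (j z)" if z: "norm z = 1" for z
    unfolding linC
  proof (intro conjI allI)
    note D_add = linear_add[OF lin[OF z]] and D_scale = linear_scale[OF lin[OF z]]
    fix h k c
    show "j z (h + k) = j z h + j z k"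
      by (simp add: j_def scale_right_distrib D_add complex_eq_iff)
    have real: "scaleC c h = Re c *\<^sub>R h + Im c *\<^sub>R scaleC \<i> h" for c h
    proof -
      have "c = of_real (Re c) + of_real (Im c) * \<i>" by (simp add: complex_eq_iff)
      then have "scaleC c h = scaleC (of_real (Re c) + of_real (Im c) * \<i>) h" by simp
      also have "\<dots> = Re c *\<^sub>R h + Im c *\<^sub>R scaleC \<i> h"
        by (simp only: scale_left_distrib scale_scale[symmetric] scale_of_real)
      finally show ?thesis .
    qed
    have i2: "scaleC \<i> (scaleC c h) = (- Im c) *\<^sub>R h + Re c *\<^sub>R scaleC \<i> h"
      using real[of "\<i> * c" h] by simp
    show "j z (scaleC c h) = c * j z h"
      unfolding j_def i2 by (subst real) (simp add: D_add D_scale complex_eq_iff del: scaleR_minus_left)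
  qed
  have j_le: "norm (j z h) \<le> norm h" if z: "norm z = 1" for z h
  proof -
    have "Re (j z k) \<le> 1 * norm k" for k
      using le[OF z, of k] by (simp add: j_def)
    then show ?thesis
      using complex_norm_le_by_rotation[OF X, of "j z" 1 h] j_lin[OF z] by (simp add: linC)
  qed
  have j_one: "j z z = 1" if z: "norm z = 1" for z
  proof -
    have "Re (j z z) = 1" using one[OF z] by (simp add: j_def)
    moreover have "(Re (j z z))\<^sup>2 + (Im (j z z))\<^sup>2 \<le> 1"
      using j_le[OF z, of z] z unfolding cmod_power2[symmetric] by (simp add: power_le_one)
    ultimately show ?thesis by (simp add: complex_eq_iff)
  qed
  show ?thesis
    unfolding uniform_smulyan_def
  proof (intro allI impI)
    fix e :: real assume "e > 0"
    then obtain d where d: "d > 0" "\<And>z \<phi> h. norm z = 1 \<Longrightarrow> linear \<phi> \<Longrightarrow> (\<And>h. \<phi> h \<le> norm h) \<Longrightarrow>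
        1 - d < \<phi> z \<Longrightarrow> \<bar>\<phi> h - D z h\<bar> \<le> e * norm h"
      using smul by meson
    have near: "norm (\<phi> h - j z h) \<le> e * norm h"
      if z: "norm z = 1" and \<phi>: "Vector_Spaces.linear scaleC (*) \<phi>" "\<And>h. norm (\<phi> h) \<le> norm h"
        "norm (\<phi> z - 1) < d" for z \<phi> h
    proof (rule complex_norm_le_by_rotation[OF X])
      show "\<phi> (scaleC c h) - j z (scaleC c h) = c * (\<phi> h - j z h)" for c h
        using \<phi>(1) j_lin[OF z] by (simp add: linC algebra_simps)
      fix h
      have "\<bar>Re (\<phi> h) - D z h\<bar> \<le> e * norm h"
      proof (rule d(2)[OF z])
        show "linear (\<lambda>h. Re (\<phi> h))"
        proof (rule linearI)
          show "Re (\<phi> (r *\<^sub>R h)) = r *\<^sub>R Re (\<phi> h)" for r h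
            using \<phi>(1) by (simp add: linC scale_of_real[symmetric])
        qed (use \<phi>(1) in \<open>simp add: linC\<close>)
        show "Re (\<phi> k) \<le> norm k" for k
          using \<phi>(2)[of k] complex_Re_le_cmod[of "\<phi> k"] by linarith
        show "1 - d < Re (\<phi> z)"
          using \<phi>(3) abs_Re_le_cmod[of "\<phi> z - 1"] by simp
      qed
      then show "Re (\<phi> h - j z h) \<le> e * norm h"
        by (simp add: j_def)
    qed
    then show "\<exists>d>0. \<forall>x\<in>sphere 0 1. \<exists>j. Vector_Spaces.linear scaleC (*) j \<and>
        (\<forall>h. norm (j h) \<le> norm h) \<and> j x = 1 \<and>
        (\<forall>\<phi>. Vector_Spaces.linear scaleC (*) \<phi> \<and> (\<forall>h. norm (\<phi> h) \<le> norm h) \<and>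
           norm (\<phi> x - 1) < d \<longrightarrow> (\<forall>h. norm (\<phi> h - j h) \<le> e * norm h))"
    proof (intro exI[of _ d] conjI ballI)
      fix x :: 'x assume "x \<in> sphere 0 1"
      then have x: "norm x = 1" by simp
      then show "\<exists>j. Vector_Spaces.linear scaleC (*) j \<and> (\<forall>h. norm (j h) \<le> norm h) \<and> j x = 1 \<and>
          (\<forall>\<phi>. Vector_Spaces.linear scaleC (*) \<phi> \<and> (\<forall>h. norm (\<phi> h) \<le> norm h) \<and>
             norm (\<phi> x - 1) < d \<longrightarrow> (\<forall>h. norm (\<phi> h - j h) \<le> e * norm h))"
        using j_lin[OF x] j_le[OF x] j_one[OF x] near[OF x] by (intro exI[of _ "j x"]) auto
    qed (rule d(1))
  qed
qed

section \<open>A power series with values in a Stolz region\<close>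

text \<open>
  The power series coefficients of \<open>1 - (1 - z) powr \<alpha>\<close>, from degree one on. They are written
  through \<open>pochhammer\<close> because this makes their sign visible for \<open>0 < \<alpha> < 1\<close>.
\<close>

definition stolz_coeff :: "real \<Rightarrow> nat \<Rightarrow> real" where
  "stolz_coeff \<alpha> n = \<alpha> * pochhammer (1 - \<alpha>) n / fact (Suc n)"

lemma stolz_coeff_nonneg: "0 < \<alpha> \<Longrightarrow> \<alpha> < 1 \<Longrightarrow> 0 \<le> stolz_coeff \<alpha> n"
  by (simp add: stolz_coeff_def pochhammer_nonneg)

lemma stolz_coeff_gbinomial:
  "of_real (stolz_coeff \<alpha> n) * z ^ Suc n = - ((of_real \<alpha> gchoose Suc n) * (- z) ^ Suc n)"
  for z :: "'a::{real_normed_field}"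
proof -
  have "(of_real \<alpha> gchoose Suc n :: 'a) = (- 1) ^ Suc n * - of_real (stolz_coeff \<alpha> n)"
    unfolding gbinomial_pochhammer pochhammer_rec stolz_coeff_def
    by (simp add: pochhammer_of_real[symmetric])
  moreover have "(- z) ^ Suc n = (- 1) ^ Suc n * z ^ Suc n"
    by (rule power_minus)
  ultimately show ?thesis by (simp add: power_mult_distrib[symmetric])
qed

lemma stolz_series_complex:
  assumes "norm (z::complex) < 1"
  shows "(\<lambda>n. of_real (stolz_coeff \<alpha> n) * z ^ Suc n) sums (1 - (1 - z) powr of_real \<alpha>)"
proof -
  have "(\<lambda>n. (of_real \<alpha> gchoose n) * (- z) ^ n) sums (1 - z) powr of_real \<alpha>"
    using gen_binomial_complex[of "- z" "of_real \<alpha>"] assms by simp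
  then have "(\<lambda>n. (of_real \<alpha> gchoose Suc n) * (- z) ^ Suc n) sums ((1 - z) powr of_real \<alpha> - 1)"
    by (subst sums_Suc_iff) simp
  from sums_minus[OF this] show ?thesis
    by (simp only: stolz_coeff_gbinomial minus_diff_eq)
qed

lemma stolz_series_real:
  assumes "\<bar>r\<bar> < 1"
  shows "(\<lambda>n. stolz_coeff \<alpha> n * r ^ Suc n) sums (1 - (1 - r) powr \<alpha>)"
proof -
  have "(\<lambda>n. (\<alpha> gchoose n) * (- r) ^ n) sums (1 - r) powr \<alpha>"
    using gen_binomial_real[of "- r" \<alpha>] assms by simp
  then have "(\<lambda>n. (\<alpha> gchoose Suc n) * (- r) ^ Suc n) sums ((1 - r) powr \<alpha> - 1)"
    by (subst sums_Suc_iff) simp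
  from sums_minus[OF this] show ?thesis
    using stolz_coeff_gbinomial[of \<alpha> _ r] by (simp only: minus_diff_eq of_real_eq_id id_apply)
qed

text \<open>
  The coefficients being nonnegative, absolute convergence on the unit circle and the value at \<open>1\<close>
  both follow from the values \<open>1 - (1 - r) powr \<alpha>\<close> of the series at \<open>0 < r < 1\<close>, which tend to \<open>1\<close>.
\<close>

lemma stolz_coeff_sums_one:
  assumes \<alpha>: "0 < \<alpha>" "\<alpha> < 1"
  shows "stolz_coeff \<alpha> sums 1"
proof -
  note nonneg = stolz_coeff_nonneg[OF \<alpha>]
  have near1: "eventually (\<lambda>r. 0 < r \<and> r < 1) (at_left (1::real))"
    using eventually_at_left[of 0 "1::real"] by (auto intro: exI[of _ 0])
  have partial: "(\<Sum>n<N. stolz_coeff \<alpha> n) \<le> 1" for N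
  proof (rule tendsto_upperbound)
    show "((\<lambda>r. \<Sum>n<N. stolz_coeff \<alpha> n * r ^ Suc n) \<longlongrightarrow> (\<Sum>n<N. stolz_coeff \<alpha> n)) (at_left 1)"
      by (rule tendsto_eq_intros refl)+ simp
    show "\<forall>\<^sub>F r in at_left 1. (\<Sum>n<N. stolz_coeff \<alpha> n * r ^ Suc n) \<le> 1"
      using near1
    proof eventually_elim
      case (elim r)
      have "(\<Sum>n<N. stolz_coeff \<alpha> n * r ^ Suc n) \<le> 1 - (1 - r) powr \<alpha>"
        using sum_le_suminf[OF sums_summable[OF stolz_series_real], of r "{..<N}" \<alpha>]
          sums_unique[OF stolz_series_real[of r \<alpha>]] elim nonneg by simp
      then show ?case using powr_ge_zero[of "1 - r" \<alpha>] by linarith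
    qed
  qed simp
  then have summ: "summable (stolz_coeff \<alpha>)"
    using nonneg by (intro summableI_nonneg_bounded[of _ 1]) auto
  have "1 \<le> suminf (stolz_coeff \<alpha>)"
  proof (rule tendsto_upperbound)
    have "((\<lambda>r. 1 - (1 - r) powr \<alpha>) \<longlongrightarrow> 1 - 0) (at_left (1::real))"
    proof (intro tendsto_diff tendsto_const)
      have "((\<lambda>r. (1 - r) powr \<alpha>) \<longlongrightarrow> (1 - 1) powr \<alpha>) (at_left (1::real))"
        using near1 \<alpha> by (intro tendsto_powr' tendsto_intros) (auto elim: eventually_mono)
      then show "((\<lambda>r. (1 - r) powr \<alpha>) \<longlongrightarrow> 0) (at_left (1::real))" by simp
    qed
    then show "((\<lambda>r. 1 - (1 - r) powr \<alpha>) \<longlongrightarrow> 1) (at_left (1::real))" by simp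
    show "\<forall>\<^sub>F r in at_left 1. 1 - (1 - r) powr \<alpha> \<le> suminf (stolz_coeff \<alpha>)"
      using near1
    proof eventually_elim
      case (elim r)
      have "stolz_coeff \<alpha> n * r ^ Suc n \<le> stolz_coeff \<alpha> n" for n
        using mult_left_mono[OF power_le_one[of r "Suc n"] nonneg[of n]] elim by simp
      then have "(\<Sum>n. stolz_coeff \<alpha> n * r ^ Suc n) \<le> suminf (stolz_coeff \<alpha>)"
        using elim by (intro suminf_le sums_summable[OF stolz_series_real] summ) auto
      then show ?case
        using sums_unique[OF stolz_series_real[of r \<alpha>]] elim by simp
    qed
  qed simp
  moreover have "suminf (stolz_coeff \<alpha>) \<le> 1"
    using summ partial by (intro suminf_le_const) auto
  ultimately show ?thesis
    using summable_sums[OF summ] by simp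
qed

text \<open>
  The power map with a small exponent sends the half-plane \<open>Re > 0\<close> into a thin sector around the
  positive axis, and \<open>norm (1 - z) < 2\<close> makes the image at most slightly longer than \<open>1\<close>. Such points
  \<open>w\<close> of length \<open>\<rho>\<close> and argument \<open>\<theta>\<close> satisfy the claim, since after squaring and division by \<open>\<rho>\<close>
  it becomes \<open>\<rho> (2 e - e\<^sup>2) \<le> 2 (cos \<theta> - 1 + e)\<close>. The exponent \<open>e / 8\<close> is small enough: it gives
  \<open>\<rho> \<le> 1 + e / 4\<close> and \<open>\<bar>\<theta>\<bar> \<le> e / 4\<close>.
\<close>

lemma norm_one_minus_le_in_sector:
  fixes e :: real and z :: complex
  assumes e: "0 < e" "e < 1" and z: "norm z < 1"
  defines "w \<equiv> (1 - z) powr of_real (e / 8)"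
  shows "norm (1 - w) + (1 - e) * norm w \<le> 1"
proof -
  have Re_pos: "0 < Re (1 - z)"
    using z complex_Re_le_cmod[of z] by simp
  then have nz: "1 - z \<noteq> 0" by auto
  define \<rho> \<theta> where "\<rho> = exp (e / 8 * ln (norm (1 - z)))" and "\<theta> = e / 8 * Im (Ln (1 - z))"
  have w: "w = exp (of_real (e / 8) * Ln (1 - z))"
    using nz by (simp add: w_def powr_def)
  have norm_w: "norm w = \<rho>"
    using nz by (simp add: w norm_exp_eq_Re \<rho>_def Re_Ln)
  have Re_w: "Re w = \<rho> * cos \<theta>"
    using nz by (simp add: w Re_exp \<rho>_def \<theta>_def)
  have "norm (1 - z) \<le> 2"
    using norm_triangle_ineq4[of 1 z] z by simp
  then have "ln (norm (1 - z)) \<le> ln 2"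
    using nz by simp
  also have "ln (2::real) \<le> 1" using ln_le_minus_one[of 2] by simp
  finally have "\<rho> \<le> exp (e / 8)"
    unfolding \<rho>_def using e mult_left_mono[of "ln (norm (1 - z))" 1 "e / 8"] by simp
  also have "\<dots> \<le> 1 + 2 * (e / 8)"
    using e by (intro real_exp_bound_lemma) auto
  finally have \<rho>: "\<rho> \<le> 1 + e / 4" "0 < \<rho>" by (simp_all add: \<rho>_def)
  have "\<bar>Im (Ln (1 - z))\<bar> < 2"
    using Re_Ln_pos_lt_imp[OF Re_pos] pi_less_4 by linarith
  then have "\<bar>\<theta>\<bar> \<le> e / 4"
    using e mult_left_mono[of "\<bar>Im (Ln (1 - z))\<bar>" 2 "e / 8"] by (simp add: \<theta>_def abs_mult)
  then have "\<bar>sin (\<theta> / 2)\<bar> \<le> e / 8"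
    using abs_sin_x_le_abs_x[of "\<theta> / 2"] by simp
  then have "(sin (\<theta> / 2))\<^sup>2 \<le> (e / 8)\<^sup>2"
    using power_mono[of "\<bar>sin (\<theta> / 2)\<bar>" "e / 8" 2] by simp
  moreover have "cos \<theta> = 1 - 2 * (sin (\<theta> / 2))\<^sup>2"
    using cos_double_sin[of "\<theta> / 2"] by simp
  ultimately have cos: "1 - e\<^sup>2 / 32 \<le> cos \<theta>"
    by (simp add: power2_eq_square)
  have "(norm (1 - w))\<^sup>2 = 1 - 2 * \<rho> * cos \<theta> + \<rho>\<^sup>2"
  proof -
    have "(norm (1 - w))\<^sup>2 = 1 - 2 * Re w + (norm w)\<^sup>2"
      unfolding cmod_power2 by (simp add: power2_eq_square algebra_simps)
    then show ?thesis by (simp add: norm_w Re_w)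
  qed
  also have "\<dots> \<le> (1 - (1 - e) * \<rho>)\<^sup>2"
  proof -
    have "\<rho> * (2 * e - e\<^sup>2) \<le> (1 + e / 4) * (2 * e - e\<^sup>2)"
      using \<rho>(1) e by (intro mult_right_mono) (auto simp: power2_eq_square)
    also have "\<dots> = 2 * e - e\<^sup>2 / 2 - e * e\<^sup>2 / 4"
      by (simp add: algebra_simps power2_eq_square)
    also have "\<dots> \<le> 2 * e - e\<^sup>2 / 16"
    proof -
      have "0 \<le> e * e\<^sup>2" using e by simp
      then show ?thesis using zero_le_power2[of e] by linarith
    qed
    also have "\<dots> \<le> 2 * (cos \<theta> - 1 + e)"
      using cos by simp
    finally have "\<rho> * (\<rho> * (2 * e - e\<^sup>2)) \<le> \<rho> * (2 * (cos \<theta> - 1 + e))"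
      using \<rho>(2) by (intro mult_left_mono) auto
    moreover have "(1 - (1 - e) * \<rho>)\<^sup>2 - (1 - 2 * \<rho> * cos \<theta> + \<rho>\<^sup>2)
        = \<rho> * (2 * (cos \<theta> - 1 + e)) - \<rho> * (\<rho> * (2 * e - e\<^sup>2))"
      by (simp add: algebra_simps power2_eq_square)
    ultimately show ?thesis by linarith
  qed
  finally have "(norm (1 - w))\<^sup>2 \<le> (1 - (1 - e) * \<rho>)\<^sup>2" .
  moreover have "(1 - e) * \<rho> \<le> 1"
  proof -
    have "(1 - e) * \<rho> \<le> (1 - e) * (1 + e / 4)"
      using \<rho>(1) e by (intro mult_left_mono) auto
    also have "\<dots> = 1 - 3 * e / 4 - e\<^sup>2 / 4" by (simp add: field_simps power2_eq_square)
    also have "\<dots> \<le> 1" using e zero_le_power2[of e] by linarith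
    finally show ?thesis .
  qed
  ultimately have "norm (1 - w) \<le> 1 - (1 - e) * \<rho>"
    using power2_le_imp_le[of "norm (1 - w)" "1 - (1 - e) * \<rho>"] by simp
  then show ?thesis unfolding norm_w by linarith
qed

text \<open>
  The series \<open>\<psi>\<close> maps the closed disc into the region \<open>norm w + (1 - e) * norm (1 - w) \<le> 1\<close> and
  fixes \<open>0\<close> and \<open>1\<close>. That region has a corner at \<open>1\<close>, which excludes polynomials; the summable
  coefficients make \<open>\<psi>\<close> a uniform limit of polynomials without constant term.
\<close>

lemma stolz_power_series:
  fixes e :: real
  assumes e: "0 < e" "e < 1"
  obtains a :: "nat \<Rightarrow> real" where "\<And>n. 0 \<le> a n" and "a sums 1"
    and "\<And>z::complex. norm z \<le> 1 \<Longrightarrow>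
       norm (\<Sum>n. of_real (a n) * z ^ Suc n) + (1 - e) * norm (1 - (\<Sum>n. of_real (a n) * z ^ Suc n)) \<le> 1"
proof
  define a where "a = stolz_coeff (e / 8)"
  show nonneg: "0 \<le> a n" for n
    using e by (simp add: a_def stolz_coeff_nonneg)
  show sums: "a sums 1"
    unfolding a_def using e by (intro stolz_coeff_sums_one) auto
  define \<psi> where "\<psi> z = (\<Sum>n. of_real (a n) * z ^ Suc n)" for z :: complex
  have "uniform_limit (cball 0 1) (\<lambda>N z. \<Sum>n<N. of_real (a n) * z ^ Suc n) \<psi> sequentially"
    unfolding \<psi>_def
  proof (rule Weierstrass_m_test)
    show "norm (of_real (a n) * z ^ Suc n) \<le> a n" if "z \<in> cball 0 1" for n and z :: complex
      using that nonneg[of n] mult_left_mono[OF power_le_one[of "norm z" "Suc n"] nonneg[of n]]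
      by (simp add: norm_mult norm_power)
    show "summable a" using sums by (rule sums_summable)
  qed
  then have cont: "continuous_on (cball 0 1) \<psi>"
    by (rule uniform_limit_theorem[rotated]) (auto intro!: continuous_intros always_eventually)
  fix z :: complex assume z: "norm z \<le> 1"
  have "norm (\<psi> z) + (1 - e) * norm (1 - \<psi> z) \<le> 1"
  proof (rule continuous_le_on_closure[where S = "ball 0 1"
        and f = "\<lambda>z. norm (\<psi> z) + (1 - e) * norm (1 - \<psi> z)"])
    show "continuous_on (closure (ball 0 1)) (\<lambda>z. norm (\<psi> z) + (1 - e) * norm (1 - \<psi> z))"
      using cont by (auto intro!: continuous_intros)
    fix y :: complex assume "y \<in> ball 0 1"
    then have y: "norm y < 1" by simp
    have "\<psi> y = 1 - (1 - y) powr of_real (e / 8)"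
      unfolding \<psi>_def a_def by (rule sums_unique[OF stolz_series_complex[OF y], symmetric])
    then show "norm (\<psi> y) + (1 - e) * norm (1 - \<psi> y) \<le> 1"
      using norm_one_minus_le_in_sector[OF e y] by simp
  qed (use z in simp)
  then show "norm (\<Sum>n. of_real (a n) * z ^ Suc n)
      + (1 - e) * norm (1 - (\<Sum>n. of_real (a n) * z ^ Suc n)) \<le> 1"
    by (simp only: \<psi>_def)
qed

section \<open>Peaking elements of a uniform algebra\<close>

lemma uniform_algebra_scale:
  fixes A :: "('c::t2_space \<Rightarrow>\<^sub>C 'k::real_normed_field) set"
  assumes "uniform_algebra A" "f \<in> A"
  shows "bcontfun_scale c f \<in> A"
proof -
  interpret normed_space_over "bcontfun_scale :: 'k \<Rightarrow> ('c \<Rightarrow>\<^sub>C 'k) \<Rightarrow> _"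
    by (rule normed_space_over_bcontfun_scale)
  show ?thesis using assms subspace_scale by (auto simp: uniform_algebra_def)
qed

lemma uniform_algebra_add:
  fixes A :: "('c::t2_space \<Rightarrow>\<^sub>C 'k::real_normed_field) set"
  assumes "uniform_algebra A" "f \<in> A" "g \<in> A"
  shows "f + g \<in> A"
proof -
  interpret normed_space_over "bcontfun_scale :: 'k \<Rightarrow> ('c \<Rightarrow>\<^sub>C 'k) \<Rightarrow> _"
    by (rule normed_space_over_bcontfun_scale)
  show ?thesis using assms subspace_add by (auto simp: uniform_algebra_def)
qed

lemma uniform_algebra_diff:
  fixes A :: "('c::t2_space \<Rightarrow>\<^sub>C 'k::real_normed_field) set"
  assumes "uniform_algebra A" "f \<in> A" "g \<in> A"
  shows "f - g \<in> A"
proof -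
  interpret normed_space_over "bcontfun_scale :: 'k \<Rightarrow> ('c \<Rightarrow>\<^sub>C 'k) \<Rightarrow> _"
    by (rule normed_space_over_bcontfun_scale)
  show ?thesis using assms subspace_diff by (auto simp: uniform_algebra_def)
qed

lemma uniform_algebra_mult:
  "uniform_algebra A \<Longrightarrow> f \<in> A \<Longrightarrow> g \<in> A \<Longrightarrow> bcontfun_mult f g \<in> A"
  by (simp add: uniform_algebra_def)

lemma uniform_algebra_power:
  assumes "uniform_algebra A" "f \<in> A"
  obtains g where "g \<in> A" "\<And>s. apply_bcontfun g s = apply_bcontfun f s ^ Suc n"
proof -
  have "\<exists>g\<in>A. \<forall>s. apply_bcontfun g s = apply_bcontfun f s ^ Suc n"
  proof (induction n)
    case 0
    then show ?case using assms(2) by auto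
  next
    case (Suc n)
    then obtain g where "g \<in> A" "\<forall>s. apply_bcontfun g s = apply_bcontfun f s ^ Suc n" by blast
    then show ?case
      using uniform_algebra_mult[OF assms, of g] by (intro bexI[of _ "bcontfun_mult f g"]) auto
  qed
  then show thesis using that by blast
qed

text \<open>
  Substitution is restricted to series without constant term, as the algebra may lack constants.
\<close>

lemma uniform_algebra_power_series:
  fixes A :: "('c::t2_space \<Rightarrow>\<^sub>C 'k::{real_normed_field, banach}) set"
  assumes A: "uniform_algebra A" and f: "f \<in> A" "norm f \<le> 1" and a: "summable (\<lambda>n. norm (a n))"
  obtains g where "g \<in> A" "\<And>s. apply_bcontfun g s = (\<Sum>n. a n * apply_bcontfun f s ^ Suc n)"
proof -
  have "\<exists>g\<in>A. \<forall>s. apply_bcontfun g s = (\<Sum>n<N. a n * apply_bcontfun f s ^ Suc n)" for N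
  proof (induction N)
    case 0
    show ?case
      using uniform_algebra_scale[OF A f(1), of 0] by (intro bexI[of _ "bcontfun_scale 0 f"]) auto
  next
    case (Suc N)
    then obtain g where g: "g \<in> A"
      "\<forall>s. apply_bcontfun g s = (\<Sum>n<N. a n * apply_bcontfun f s ^ Suc n)" by blast
    obtain p where p: "p \<in> A" "\<And>s. apply_bcontfun p s = apply_bcontfun f s ^ Suc N"
      using uniform_algebra_power[OF A f(1)] by blast
    show ?case
      using g p uniform_algebra_add[OF A g(1) uniform_algebra_scale[OF A p(1)], of "a N"]
      by (intro bexI[of _ "g + bcontfun_scale (a N) p"]) auto
  qed
  then obtain F where F: "\<And>N. F N \<in> A"
    "\<And>N s. apply_bcontfun (F N) s = (\<Sum>n<N. a n * apply_bcontfun f s ^ Suc n)"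
    by metis
  have "uniform_limit UNIV (\<lambda>N s. \<Sum>n<N. a n * apply_bcontfun f s ^ Suc n)
      (\<lambda>s. \<Sum>n. a n * apply_bcontfun f s ^ Suc n) sequentially"
  proof (rule Weierstrass_m_test[OF _ a])
    fix n s
    have "norm (apply_bcontfun f s) \<le> 1"
      using norm_bounded[of f s] f(2) by linarith
    then show "norm (a n * apply_bcontfun f s ^ Suc n) \<le> norm (a n)"
      by (metis norm_mult norm_power mult_left_le norm_ge_zero power_le_one)
  qed
  then have lim: "uniform_limit UNIV (\<lambda>N. apply_bcontfun (F N))
      (\<lambda>s. \<Sum>n. a n * apply_bcontfun f s ^ Suc n) sequentially"
    by (simp add: F(2)[abs_def])
  from uniform_limit_bcontfunE[OF lim] obtain g
    where g: "(\<lambda>s. \<Sum>n. a n * apply_bcontfun f s ^ Suc n) = apply_bcontfun g"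
    by auto
  have "F \<longlonglongrightarrow> g"
    using lim unfolding g by (rule uniform_limit_tendsto_bcontfun)
  moreover have "closed A" using A by (simp add: uniform_algebra_def)
  ultimately have "g \<in> A"
    using F(1) closed_sequentially by blast
  then show thesis using that fun_cong[OF g, symmetric] by blast
qed

text \<open>
  Every element peaking at a point can be sharpened to one that is small away from the peak and takes
  its values in the Stolz region with vertex \<open>1\<close>.
\<close>

definition has_stolz_peaks :: "('c::t2_space \<Rightarrow>\<^sub>C 'k::real_normed_field) set \<Rightarrow> bool" where
  "has_stolz_peaks A \<longleftrightarrow> (\<forall>u\<in>A. \<forall>s\<^sub>0. norm u \<le> 1 \<and> apply_bcontfun u s\<^sub>0 = 1 \<longrightarrow>
     (\<forall>e>0. \<forall>d>0. e < 1 \<longrightarrow> (\<exists>f\<in>A. apply_bcontfun f s\<^sub>0 = 1 \<and>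
        (\<forall>s. norm (apply_bcontfun f s) + (1 - e) * norm (1 - apply_bcontfun f s) \<le> 1) \<and>
        (\<forall>s. d \<le> norm (apply_bcontfun u s - 1) \<longrightarrow> norm (apply_bcontfun f s) \<le> e))))"

text \<open>
  By the parallelogram law, \<open>norm (1 + v)\<close> stays away from \<open>2\<close> when \<open>v\<close> stays away from \<open>1\<close>. The further
  factor \<open>v\<close> turns \<open>(1 + v) / 2\<close> into a polynomial without constant term.
\<close>

lemma norm_half_one_plus_less:
  fixes v :: "'k::{real_normed_field, real_inner}"
  assumes v: "norm v \<le> 1" and d: "d \<le> norm (v - 1)" "0 < d"
  shows "norm ((v + v\<^sup>2) / 2) \<le> sqrt (1 - d\<^sup>2 / 4)"
proof -
  have "(norm (1 + v))\<^sup>2 + (norm (v - 1))\<^sup>2 = 2 + 2 * (norm v)\<^sup>2"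
    by (simp add: power2_norm_eq_inner inner_simps inner_commute norm_eq_1[symmetric])
  also have "\<dots> \<le> 4" using power_le_one[of "norm v" 2] v by simp
  finally have "(norm (1 + v))\<^sup>2 \<le> 4 - (norm (v - 1))\<^sup>2" by simp
  also have "\<dots> \<le> 4 - d\<^sup>2" using d power_mono[of d "norm (v - 1)" 2] by simp
  finally have "(norm (1 + v) / 2)\<^sup>2 \<le> 1 - d\<^sup>2 / 4" by (simp add: power_divide)
  then have *: "norm (1 + v) / 2 \<le> sqrt (1 - d\<^sup>2 / 4)" by (rule real_le_rsqrt)
  have "norm ((v + v\<^sup>2) / 2) = norm v * (norm (1 + v) / 2)"
  proof -
    have "v + v\<^sup>2 = v * (1 + v)" by (simp add: power2_eq_square algebra_simps)
    then show ?thesis by (simp only: norm_mult norm_divide norm_numeral times_divide_eq_right)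
  qed
  also have "\<dots> \<le> norm (1 + v) / 2" using v by (simp add: mult_left_le_one_le)
  finally show ?thesis using * by linarith
qed

text \<open>
  High powers of \<open>(u + u\<^sup>2) / 2\<close> peak as sharply as desired. The exponent is chosen even so that real
  functions become nonnegative.
\<close>

lemma uniform_algebra_peak:
  fixes A :: "('c::t2_space \<Rightarrow>\<^sub>C 'k::{real_normed_field, real_inner}) set"
  assumes A: "uniform_algebra A" and u: "u \<in> A" "norm u \<le> 1" "apply_bcontfun u s\<^sub>0 = 1"
    and e: "0 < e" and d: "0 < d"
  obtains h v n where "h \<in> A" "even n" "apply_bcontfun h s\<^sub>0 = 1" "norm h \<le> 1"
    "\<And>s. apply_bcontfun h s = v s ^ n"
    "\<And>s. d \<le> norm (apply_bcontfun u s - 1) \<Longrightarrow> norm (apply_bcontfun h s) \<le> e"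
proof -
  define v where "v = bcontfun_scale (1 / 2) (u + bcontfun_mult u u)"
  have v: "v \<in> A" "\<And>s. apply_bcontfun v s = (apply_bcontfun u s + (apply_bcontfun u s)\<^sup>2) / 2"
    unfolding v_def
    by (intro uniform_algebra_scale uniform_algebra_add uniform_algebra_mult A u)
      (simp add: power2_eq_square)
  have u_le: "norm (apply_bcontfun u s) \<le> 1" for s
    using norm_bounded[of u s] u(2) by linarith
  have v_le: "norm (apply_bcontfun v s) \<le> 1" for s
  proof -
    have "norm (apply_bcontfun u s + (apply_bcontfun u s)\<^sup>2) \<le> 1 + 1"
      using u_le[of s] by (intro norm_triangle_mono) (simp_all add: norm_power power_le_one)
    then show ?thesis by (simp add: v norm_divide)
  qed
  \<comment> \<open>The minimum with \<open>1\<close> keeps the radicand positive.\<close>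
  define q where "q = sqrt (1 - (min d 1)\<^sup>2 / 4)"
  have "(min d 1)\<^sup>2 \<le> 1" "0 < (min d 1)\<^sup>2"
    using d by (auto intro: power_le_one)
  then have q: "0 \<le> q" "q < 1"
    by (auto simp: q_def)
  have v_far: "norm (apply_bcontfun v s) \<le> q" if "d \<le> norm (apply_bcontfun u s - 1)" for s
    unfolding v q_def using that d by (intro norm_half_one_plus_less u_le) auto
  obtain m where m: "q ^ m < e"
    using real_arch_pow_inv[OF e q(2)] by blast
  obtain h where h: "h \<in> A" "\<And>s. apply_bcontfun h s = apply_bcontfun v s ^ Suc (2 * m + 1)"
    using uniform_algebra_power[OF A v(1)] by blast
  show thesis
  proof (rule that[OF h(1) _ _ _ h(2)])
    show "apply_bcontfun h s\<^sub>0 = 1" by (simp add: h(2) v(2) u(3))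
    show "norm h \<le> 1"
      by (rule norm_bound) (simp only: h(2) norm_power power_le_one[OF norm_ge_zero v_le])
    fix s assume "d \<le> norm (apply_bcontfun u s - 1)"
    then have "norm (apply_bcontfun h s) \<le> q ^ Suc (2 * m + 1)"
      unfolding h(2) norm_power by (intro power_mono v_far) auto
    also have "\<dots> \<le> q ^ m"
      using q by (intro power_decreasing) auto
    finally show "norm (apply_bcontfun h s) \<le> e" using m by simp
  qed simp
qed

text \<open>
  The interval from \<open>0\<close> to \<open>1\<close> lies in the Stolz region, so an even power suffices.
\<close>

lemma has_stolz_peaks_real:
  fixes A :: "('c::t2_space \<Rightarrow>\<^sub>C real) set"
  assumes A: "uniform_algebra A"
  shows "has_stolz_peaks A"
  unfolding has_stolz_peaks_def
proof (intro ballI allI impI, elim conjE)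
  fix u s\<^sub>0 and e d :: real
  assume u: "u \<in> A" "norm u \<le> 1" "apply_bcontfun u s\<^sub>0 = 1" and e: "0 < e" "e < 1" and d: "0 < d"
  obtain h v n where h: "h \<in> A" "even n" "apply_bcontfun h s\<^sub>0 = 1" "norm h \<le> 1"
    "\<And>s. apply_bcontfun h s = v s ^ n"
    "\<And>s. d \<le> norm (apply_bcontfun u s - 1) \<Longrightarrow> norm (apply_bcontfun h s) \<le> e"
    using uniform_algebra_peak[OF A u e(1) d] by metis
  have "norm (apply_bcontfun h s) + (1 - e) * norm (1 - apply_bcontfun h s) \<le> 1" for s
  proof -
    have "0 \<le> apply_bcontfun h s" unfolding h(5) by (rule zero_le_even_power[OF h(2)])
    moreover have "apply_bcontfun h s \<le> 1" using norm_bounded[of h s] h(4) by simp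
    ultimately show ?thesis
      using e mult_nonneg_nonneg[of e "1 - apply_bcontfun h s"] by (simp add: algebra_simps)
  qed
  then show "\<exists>f\<in>A. apply_bcontfun f s\<^sub>0 = 1 \<and>
      (\<forall>s. norm (apply_bcontfun f s) + (1 - e) * norm (1 - apply_bcontfun f s) \<le> 1) \<and>
      (\<forall>s. d \<le> norm (apply_bcontfun u s - 1) \<longrightarrow> norm (apply_bcontfun f s) \<le> e)"
    using h by (intro bexI[of _ h]) auto
qed

text \<open>
  The sharp peak is pushed into the Stolz region by the series \<open>\<psi>\<close>. Since the coefficients are
  nonnegative with sum one, \<open>norm (\<psi> z) \<le> norm z\<close>, and smallness away from the peak is preserved.
\<close>

lemma has_stolz_peaks_complex:
  fixes A :: "('c::t2_space \<Rightarrow>\<^sub>C complex) set"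
  assumes A: "uniform_algebra A"
  shows "has_stolz_peaks A"
  unfolding has_stolz_peaks_def
proof (intro ballI allI impI, elim conjE)
  fix u s\<^sub>0 and e d :: real
  assume u: "u \<in> A" "norm u \<le> 1" "apply_bcontfun u s\<^sub>0 = 1" and e: "0 < e" "e < 1" and d: "0 < d"
  obtain h where h: "h \<in> A" "apply_bcontfun h s\<^sub>0 = 1" "norm h \<le> 1"
    "\<And>s. d \<le> norm (apply_bcontfun u s - 1) \<Longrightarrow> norm (apply_bcontfun h s) \<le> e"
    using uniform_algebra_peak[OF A u e(1) d] by metis
  obtain a :: "nat \<Rightarrow> real" where a: "\<And>n. 0 \<le> a n" "a sums 1"
    and stolz: "\<And>z::complex. norm z \<le> 1 \<Longrightarrow>
       norm (\<Sum>n. of_real (a n) * z ^ Suc n) + (1 - e) * norm (1 - (\<Sum>n. of_real (a n) * z ^ Suc n)) \<le> 1"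
    using stolz_power_series[OF e] by blast
  have summ: "summable (\<lambda>n. norm (complex_of_real (a n)))"
    using a sums_summable[OF a(2)] by simp
  obtain f where f: "f \<in> A" "\<And>s. apply_bcontfun f s = (\<Sum>n. of_real (a n) * apply_bcontfun h s ^ Suc n)"
    using uniform_algebra_power_series[OF A h(1,3) summ] by blast
  have h_le: "norm (apply_bcontfun h s) \<le> 1" for s
    using norm_bounded[of h s] h(3) by linarith
  have small: "norm (apply_bcontfun f s) \<le> norm (apply_bcontfun h s)" for s
  proof -
    have sums: "(\<lambda>n. a n * norm (apply_bcontfun h s)) sums norm (apply_bcontfun h s)"
      using sums_mult2[OF a(2), of "norm (apply_bcontfun h s)"] by simp
    have "norm (of_real (a n) * apply_bcontfun h s ^ Suc n) \<le> a n * norm (apply_bcontfun h s)" for n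
    proof -
      have "norm (apply_bcontfun h s) ^ Suc n \<le> norm (apply_bcontfun h s) ^ 1"
        by (rule power_decreasing) (simp_all add: h_le)
      then have "a n * norm (apply_bcontfun h s) ^ Suc n \<le> a n * norm (apply_bcontfun h s)"
        using a(1)[of n] by (intro mult_left_mono) simp_all
      then show ?thesis using a(1)[of n] by (simp add: norm_mult norm_power)
    qed
    then have "norm (apply_bcontfun f s) \<le> (\<Sum>n. a n * norm (apply_bcontfun h s))"
      unfolding f(2) by (rule norm_suminf_le[OF _ sums_summable[OF sums]])
    then show ?thesis by (simp only: sums_unique[OF sums, symmetric])
  qed
  show "\<exists>f\<in>A. apply_bcontfun f s\<^sub>0 = 1 \<and>
      (\<forall>s. norm (apply_bcontfun f s) + (1 - e) * norm (1 - apply_bcontfun f s) \<le> 1) \<and>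
      (\<forall>s. d \<le> norm (apply_bcontfun u s - 1) \<longrightarrow> norm (apply_bcontfun f s) \<le> e)"
  proof (intro bexI[of _ f] conjI allI impI)
    show "apply_bcontfun f s\<^sub>0 = 1"
      using sums_of_real[OF a(2), where 'a = complex] by (simp add: f(2) h(2) sums_iff)
    show "norm (apply_bcontfun f s) + (1 - e) * norm (1 - apply_bcontfun f s) \<le> 1" for s
      unfolding f(2) by (rule stolz[OF h_le])
    show "norm (apply_bcontfun f s) \<le> e" if "d \<le> norm (apply_bcontfun u s - 1)" for s
      using h(4)[OF that] small[of s] by linarith
  qed (rule f(1))
qed

section \<open>The perturbed operator\<close>

lemma bcontfun_attains_norm:
  fixes f :: "'c::topological_space \<Rightarrow>\<^sub>C 'k::real_normed_vector"
  assumes "compact (UNIV :: 'c set)"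
  obtains s where "norm (apply_bcontfun f s) = norm f"
proof -
  have "continuous_on UNIV (\<lambda>s. norm (apply_bcontfun f s))"
    by (intro continuous_intros) auto
  then obtain s where "\<And>t. norm (apply_bcontfun f t) \<le> norm (apply_bcontfun f s)"
    using continuous_attains_sup[OF assms] by blast
  then show thesis
    using norm_bound[of f] norm_bounded[of f s] that[of s] by (simp add: order_antisym)
qed

text \<open>
  The operator \<open>f \<cdot> j + (1 - e) (1 - f) \<cdot> T\<close> replaces \<open>T\<close> by the functional \<open>j\<close> where \<open>f\<close> is close to \<open>1\<close>
  and almost keeps it where \<open>f\<close> is close to \<open>0\<close>. The Stolz condition on \<open>f\<close> says precisely that the
  absolute values of the two weights add up to at most one. Expanded, the formula contains no constant function, so the values
  stay in the algebra.
\<close>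

lemma stolz_interpolation_operator:
  fixes scaleX :: "'k::real_normed_field \<Rightarrow> 'x::real_normed_vector \<Rightarrow> 'x"
    and A :: "('c::t2_space \<Rightarrow>\<^sub>C 'k) set"
  assumes X: "normed_space_over scaleX" and A: "uniform_algebra A"
    and T: "T \<in> operators_into scaleX bcontfun_scale A" "norm T \<le> 1"
    and j: "Vector_Spaces.linear scaleX (*) j" "\<And>h. norm (j h) \<le> norm h"
    and f: "f \<in> A" "\<And>s. norm (apply_bcontfun f s) + (1 - e) * norm (1 - apply_bcontfun f s) \<le> 1"
    and e: "e < 1"
  obtains S where "S \<in> operators_into scaleX bcontfun_scale A" "norm S \<le> 1"
    "\<And>h s. apply_bcontfun (blinfun_apply S h) s =
       j h * apply_bcontfun f s + of_real (1 - e) * ((1 - apply_bcontfun f s) * apply_bcontfun (blinfun_apply T h) s)"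
proof -
  interpret X: normed_space_over scaleX by (rule X)
  interpret C: normed_space_over "bcontfun_scale :: 'k \<Rightarrow> ('c \<Rightarrow>\<^sub>C 'k) \<Rightarrow> _"
    by (rule normed_space_over_bcontfun_scale)
  have T_lin: "blinfun_apply T (scaleX c h) = bcontfun_scale c (blinfun_apply T h)" for c h
    using T(1) by (simp add: operators_into_def Vector_Spaces.linear_iff)
  have T_in: "blinfun_apply T h \<in> A" for h
    using T(1) by (auto simp: operators_into_def)
  have j_add: "j (h + k) = j h + j k" and j_scale: "j (scaleX c h) = c * j h" for h k c
    using j(1) by (simp_all add: Vector_Spaces.linear_iff)
  define S where "S h = bcontfun_scale (j h) f + bcontfun_scale (of_real (1 - e))
      (blinfun_apply T h - bcontfun_mult f (blinfun_apply T h))" for h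
  have S: "apply_bcontfun (S h) s =
       j h * apply_bcontfun f s + of_real (1 - e) * ((1 - apply_bcontfun f s) * apply_bcontfun (blinfun_apply T h) s)" for h s
    by (simp add: S_def algebra_simps)
  have S_add: "S (h + k) = S h + S k" for h k
    by (rule bcontfun_eqI) (simp add: S j_add blinfun.add_right algebra_simps)
  have S_scale: "S (scaleX c h) = bcontfun_scale c (S h)" for c h
    by (rule bcontfun_eqI) (simp add: S j_scale T_lin algebra_simps)
  have S_in: "S h \<in> A" for h
    unfolding S_def
    by (intro uniform_algebra_add uniform_algebra_scale uniform_algebra_diff uniform_algebra_mult A f T_in)
  have S_le: "norm (S h) \<le> norm h" for h
  proof (rule norm_bound)
    fix s
    have "norm (apply_bcontfun (blinfun_apply T h) s) \<le> norm h"
      using norm_bounded[of "blinfun_apply T h" s] norm_blinfun[of T h]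
        mult_left_le_one_le[OF norm_ge_zero[of h] norm_ge_zero T(2)] by linarith
    then have "norm (apply_bcontfun (S h) s)
      \<le> norm h * norm (apply_bcontfun f s) + (1 - e) * (norm (1 - apply_bcontfun f s) * norm h)"
      unfolding S using e j(2)
      by (intro norm_triangle_mono) (auto simp: norm_mult simp del: of_real_diff intro!: mult_left_mono mult_right_mono)
    also have "\<dots> = norm h * (norm (apply_bcontfun f s) + (1 - e) * norm (1 - apply_bcontfun f s))"
      by (simp add: algebra_simps)
    also have "\<dots> \<le> norm h" using f(2) by (simp add: mult_left_le)
    finally show "norm (apply_bcontfun (S h) s) \<le> norm h" .
  qed
  have "bounded_linear S"
  proof (rule bounded_linear_intro)
    show "S (r *\<^sub>R h) = r *\<^sub>R S h" for r h
      using S_scale[of "of_real r" h] by (simp add: X.scale_of_real C.scale_of_real)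
    show "norm (S h) \<le> norm h * 1" for h using S_le by simp
  qed (rule S_add)
  then have app: "blinfun_apply (Blinfun S) = S" by (rule bounded_linear_Blinfun_apply)
  show thesis
  proof (rule that)
    show "Blinfun S \<in> operators_into scaleX bcontfun_scale A"
      using S_in by (auto simp: operators_into_def app Vector_Spaces.linear_iff S_add S_scale
          X.vector_space_axioms C.vector_space_axioms)
    show "norm (Blinfun S) \<le> 1"
      by (rule norm_blinfun_bound) (simp_all add: app S_le)
  qed (simp add: app S)
qed

text \<open>
  Let \<open>g = T x\<close> attain its norm at \<open>s\<^sub>0\<close>. Normalised to the value \<open>1\<close> at \<open>s\<^sub>0\<close> it becomes a peaking
  element \<open>u\<close>. At points \<open>s\<close> where \<open>u\<close> is close to \<open>1\<close>, the functional \<open>h \<mapsto> c T h s\<close>, with a unimodular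
  constant \<open>c\<close>, has a value close to \<open>1\<close> at \<open>x\<close>, so it is close to the norming functional \<open>j\<close>; elsewhere
  the Stolz peak \<open>f\<close> obtained from \<open>u\<close> is small. Hence replacing \<open>T\<close> by \<open>inverse c * j\<close> with weight \<open>f\<close>
  changes little, and at \<open>s\<^sub>0\<close> the new operator maps \<open>x\<close> to a scalar of modulus one.
\<close>

lemma BPBpp_of_smulyan_and_peaks:
  fixes scaleX :: "'k::real_normed_field \<Rightarrow> 'x::real_normed_vector \<Rightarrow> 'x"
    and A :: "('c::t2_space \<Rightarrow>\<^sub>C 'k) set"
  assumes X: "normed_space_over scaleX" and A: "uniform_algebra A"
    and smulyan: "uniform_smulyan scaleX" and peaks: "has_stolz_peaks A"
  shows "BPBpp scaleX bcontfun_scale A"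
  unfolding BPBpp_def
proof (intro allI impI)
  fix \<epsilon> :: real assume "\<epsilon> > 0"
  \<comment> \<open>The error estimate at the end gives \<open>norm (S - T) \<le> 4 e\<close>.\<close>
  define e where "e = min (1 / 2) (\<epsilon> / 5)"
  have e: "0 < e" "e < 1" "4 * e < \<epsilon>" using \<open>\<epsilon> > 0\<close> by (auto simp: e_def min_def)
  obtain d where d: "d > 0" and near: "\<And>x. norm x = 1 \<Longrightarrow> \<exists>j. Vector_Spaces.linear scaleX (*) j \<and>
      (\<forall>h. norm (j h) \<le> norm h) \<and> j x = 1 \<and>
      (\<forall>\<phi>. Vector_Spaces.linear scaleX (*) \<phi> \<and> (\<forall>h. norm (\<phi> h) \<le> norm h) \<and> norm (\<phi> x - 1) < d \<longrightarrow>
        (\<forall>h. norm (\<phi> h - j h) \<le> e * norm h))"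
    using smulyan e(1) unfolding uniform_smulyan_def by (metis mem_sphere_0)
  define \<eta> where "\<eta> = min (1 / 2) (d / 2)"
  have \<eta>: "0 < \<eta>" "\<eta> < 1" "\<eta> \<le> d / 2" using d by (auto simp: \<eta>_def)
  have "\<exists>S \<in> operators_into scaleX bcontfun_scale A.
      norm S = 1 \<and> norm (blinfun_apply S x) = 1 \<and> norm (S - T) < \<epsilon>"
    if T: "T \<in> operators_into scaleX bcontfun_scale A" "norm T = 1"
      and x: "norm x = 1" and Tx: "1 - \<eta> < norm (blinfun_apply T x)" for T x
  proof -
    have T_le: "norm (apply_bcontfun (blinfun_apply T h) s) \<le> norm h" for h s
      using norm_bounded[of "blinfun_apply T h" s] norm_blinfun[of T h] T(2) by simp
    have T_add: "blinfun_apply T (h + k) = blinfun_apply T h + blinfun_apply T k"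
      and T_scale: "blinfun_apply T (scaleX c h) = bcontfun_scale c (blinfun_apply T h)"
      and T_in: "blinfun_apply T h \<in> A" for h k c
      using T(1) by (auto simp: operators_into_def Vector_Spaces.linear_iff)
    obtain j where j: "Vector_Spaces.linear scaleX (*) j" "\<And>h. norm (j h) \<le> norm h" "j x = 1"
      and j_near: "\<And>\<phi> h. Vector_Spaces.linear scaleX (*) \<phi> \<Longrightarrow> (\<And>h. norm (\<phi> h) \<le> norm h) \<Longrightarrow>
        norm (\<phi> x - 1) < d \<Longrightarrow> norm (\<phi> h - j h) \<le> e * norm h"
      using near[OF x] by meson
    define g where "g = blinfun_apply T x"
    have g_in: "g \<in> A" by (simp add: g_def T_in)
    obtain s\<^sub>0 where s\<^sub>0: "norm (apply_bcontfun g s\<^sub>0) = norm g"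
      using bcontfun_attains_norm A unfolding uniform_algebra_def by metis
    define M where "M = norm g"
    have M: "1 - \<eta> < M" "M \<le> 1" "0 < M"
      using Tx \<eta> norm_blinfun[of T x] T(2) x by (auto simp: M_def g_def)
    have g0: "apply_bcontfun g s\<^sub>0 \<noteq> 0" using M s\<^sub>0 by (auto simp: M_def)
    define u where "u = bcontfun_scale (inverse (apply_bcontfun g s\<^sub>0)) g"
    define c where "c = of_real M * inverse (apply_bcontfun g s\<^sub>0)"
    have c: "norm c = 1" using s\<^sub>0 M by (simp add: c_def norm_mult norm_inverse M_def)
    then have c0: "c \<noteq> 0" by auto
    have u_in: "u \<in> A" unfolding u_def by (intro uniform_algebra_scale A g_in)
    have u_le: "norm (apply_bcontfun u s) \<le> 1" for s
    proof -
      have "norm (apply_bcontfun u s) = inverse M * norm (apply_bcontfun g s)"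
        unfolding u_def apply_bcontfun_scale norm_mult norm_inverse s\<^sub>0 M_def ..
      also have "\<dots> \<le> inverse M * M"
        using norm_bounded[of g s] M by (intro mult_left_mono) (simp_all add: M_def)
      finally show ?thesis using M(3) by simp
    qed
    have u_norm: "norm u \<le> 1" by (rule norm_bound[OF u_le])
    have u0: "apply_bcontfun u s\<^sub>0 = 1" using g0 by (simp add: u_def)
    have cg: "c * apply_bcontfun g s = of_real M * apply_bcontfun u s" for s
      by (simp add: c_def u_def)
    obtain f where f: "f \<in> A" "apply_bcontfun f s\<^sub>0 = 1"
      "\<And>s. norm (apply_bcontfun f s) + (1 - e) * norm (1 - apply_bcontfun f s) \<le> 1"
      "\<And>s. d / 2 \<le> norm (apply_bcontfun u s - 1) \<Longrightarrow> norm (apply_bcontfun f s) \<le> e"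
      using peaks[unfolded has_stolz_peaks_def, rule_format, OF u_in conjI[OF u_norm u0] e(1) _ e(2), of "d / 2"] d
      by auto
    have f_le: "norm (apply_bcontfun f s) \<le> 1" for s
    proof -
      have "0 \<le> (1 - e) * norm (1 - apply_bcontfun f s)" using e(2) by simp
      then show ?thesis using f(3)[of s] by linarith
    qed
    have close: "norm (inverse c * j h - apply_bcontfun (blinfun_apply T h) s) \<le> e * norm h"
      if s: "norm (apply_bcontfun u s - 1) < d / 2" for h s
    proof -
      define \<phi> where "\<phi> k = c * apply_bcontfun (blinfun_apply T k) s" for k
      have "norm (\<phi> h - j h) \<le> e * norm h"
      proof (rule j_near)
        show "Vector_Spaces.linear scaleX (*) \<phi>"
          using j(1) by (simp add: Vector_Spaces.linear_iff \<phi>_def T_add T_scale algebra_simps)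
        show "norm (\<phi> k) \<le> norm k" for k by (simp add: \<phi>_def norm_mult c T_le)
        have "\<phi> x - 1 = of_real M * (apply_bcontfun u s - 1) - of_real (1 - M)"
          using cg[of s] by (simp add: \<phi>_def g_def algebra_simps)
        then have "norm (\<phi> x - 1) \<le> M * norm (apply_bcontfun u s - 1) + (1 - M)"
          using norm_triangle_ineq4[of "of_real M * (apply_bcontfun u s - 1)" "of_real (1 - M) :: 'k"] M
          by (simp add: norm_mult del: of_real_diff)
        also have "M * norm (apply_bcontfun u s - 1) \<le> norm (apply_bcontfun u s - 1)"
          using M by (simp add: mult_left_le_one_le)
        finally show "norm (\<phi> x - 1) < d" using s M \<eta> by linarith
      qed
      moreover have "\<phi> h - j h = - c * (inverse c * j h - apply_bcontfun (blinfun_apply T h) s)"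
        using c0 by (simp add: \<phi>_def algebra_simps)
      ultimately show ?thesis by (simp add: norm_mult c)
    qed
    have j': "Vector_Spaces.linear scaleX (*) (\<lambda>h. inverse c * j h)"
      using j(1) by (simp add: Vector_Spaces.linear_iff algebra_simps)
    have j'_le: "norm (inverse c * j h) \<le> norm h" for h
      using j(2) by (simp add: norm_mult norm_inverse c)
    obtain S where S: "S \<in> operators_into scaleX bcontfun_scale A" "norm S \<le> 1"
      "\<And>h s. apply_bcontfun (blinfun_apply S h) s = inverse c * j h * apply_bcontfun f s
         + of_real (1 - e) * ((1 - apply_bcontfun f s) * apply_bcontfun (blinfun_apply T h) s)"
      using stolz_interpolation_operator[OF X A T(1) eq_refl[OF T(2)] j' j'_le f(1,3) e(2)] by blast
    have "norm (apply_bcontfun (blinfun_apply S x) s\<^sub>0) = 1"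
      by (simp add: S(3) f(2) j(3) norm_inverse c)
    then have Sx: "1 \<le> norm (blinfun_apply S x)"
      by (metis norm_bounded)
    then have "norm (blinfun_apply S x) = 1" "norm S = 1"
      using norm_blinfun[of S x] S(2) x by auto
    moreover have "norm (S - T) \<le> 4 * e"
    proof (rule norm_blinfun_bound)
      fix h
      show "norm (blinfun_apply (S - T) h) \<le> 4 * e * norm h"
      proof (rule norm_bound)
        fix s
        define F t where "F = apply_bcontfun f s" and "t = apply_bcontfun (blinfun_apply T h) s"
        have F_le: "norm F \<le> 1" and t_le: "norm t \<le> norm h"
          by (simp_all add: F_def t_def f_le T_le)
        have "apply_bcontfun (blinfun_apply (S - T) h) s
            = F * (inverse c * j h - t) - of_real e * ((1 - F) * t)"
          by (simp add: blinfun.diff_left S(3) F_def t_def algebra_simps)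
        then have "norm (apply_bcontfun (blinfun_apply (S - T) h) s)
            \<le> norm F * norm (inverse c * j h - t) + e * (norm (1 - F) * norm t)"
          using norm_triangle_ineq4[of "F * (inverse c * j h - t)" "of_real e * ((1 - F) * t)"] e
          by (simp add: norm_mult)
        also have "norm F * norm (inverse c * j h - t) \<le> 2 * e * norm h"
        proof (cases "norm (apply_bcontfun u s - 1) < d / 2")
          case True
          have "norm F * norm (inverse c * j h - t) \<le> 1 * (e * norm h)"
            using close[OF True, of h] F_le by (intro mult_mono) (auto simp: t_def)
          also have "\<dots> \<le> 2 * e * norm h" using e by simp
          finally show ?thesis .
        next
          case False
          then have "norm F \<le> e" using f(4)[of s] by (simp add: F_def)
          moreover have "norm (inverse c * j h - t) \<le> 2 * norm h"
            using norm_triangle_ineq4[of "inverse c * j h" t] j'_le[of h] t_le by linarith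
          ultimately have "norm F * norm (inverse c * j h - t) \<le> e * (2 * norm h)"
            using e by (intro mult_mono) auto
          then show ?thesis by simp
        qed
        also have "e * (norm (1 - F) * norm t) \<le> e * (2 * norm h)"
        proof (intro mult_left_mono mult_mono)
          show "norm (1 - F) \<le> 2" using norm_triangle_ineq4[of 1 F] F_le by simp
        qed (use t_le e in auto)
        finally show "norm (apply_bcontfun (blinfun_apply (S - T) h) s) \<le> 4 * e * norm h" by simp
      qed
    qed (use e in simp)
    ultimately show ?thesis using S(1) e(3) by (intro bexI[of _ S]) auto
  qed
  then show "\<exists>\<eta>>0. \<forall>T \<in> operators_into scaleX bcontfun_scale A. \<forall>x \<in> sphere 0 1.
        norm T = 1 \<and> norm (blinfun_apply T x) > 1 - \<eta> \<longrightarrow>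
        (\<exists>S \<in> operators_into scaleX bcontfun_scale A.
           norm S = 1 \<and> norm (blinfun_apply S x) = 1 \<and> norm (S - T) < \<epsilon>)"
    using \<eta>(1) by (intro exI[of _ \<eta>]) auto
qed

theorem theorem2p6:
  fixes scaleC :: "complex \<Rightarrow> 'x::banach \<Rightarrow> 'x"
    and A :: "('c::t2_space \<Rightarrow>\<^sub>C real) set"
    and B :: "('c \<Rightarrow>\<^sub>C complex) set"
  assumes "uniformly_smooth TYPE('x)"
  shows "(uniform_algebra A \<longrightarrow> BPBpp ((*\<^sub>R) :: real \<Rightarrow> 'x \<Rightarrow> 'x) bcontfun_scale A) \<and>
         (normed_space_over scaleC \<and> uniform_algebra B \<longrightarrow> BPBpp scaleC bcontfun_scale B)"
  using BPBpp_of_smulyan_and_peaks[OF normed_space_over_scaleR _ uniform_smulyan_scaleR[OF assms] has_stolz_peaks_real]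
    BPBpp_of_smulyan_and_peaks[OF _ _ uniform_smulyan_complex[OF assms] has_stolz_peaks_complex]
  by blast

end
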